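(* For every pair of positive integers $s\le t$, there is a $K_{s,t}$-free bipartite circle graph whose minimum degree is equal to $\max\{2s-2,\,t-1\}$.
   Context: Graphs are finite and simple, with at least one vertex. A graph is $F$-free if it has no (not necessarily induced) subgraph isomorphic to $F$. A circle graph is the intersection graph of a finite collection of chords of a circle (vertices are the chords, two being adjacent exactly when the chords intersect). A bipartite circle graph is a circle graph that is bipartite. *)

theory Defs
  imports
    "HOL-Analysis.Analysis"
    "Graph_Theory.Kuratowski"
begin

(* Finite simple graphs are the symmetric, loop-free digraphs without parallel arcs of the
   locale graph: an edge uv is the pair of arcs (u,v) and (v,u), so the degree of a vertex
   is its out-degree. *)

definition min_degree :: "('a, 'b) pre_digraph \<Rightarrow> nat" where
  "min_degree G = Min (out_degree G ` verts G)"

definition bipartite_graph :: "('a, 'b) pre_digraph \<Rightarrow> bool" where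
  "bipartite_graph G \<longleftrightarrow> graph G \<and>
     (\<exists>U V. verts G = U \<union> V \<and> U \<inter> V = {} \<and> arcs_ends G \<subseteq> U \<times> V \<union> V \<times> U)"

(* Subgraphs need not be induced. The predicate on H holds exactly for the graphs
   isomorphic to the complete bipartite graph with parts of sizes s and t. *)
definition complete_bipartite_free :: "nat \<Rightarrow> nat \<Rightarrow> ('a, 'b) pre_digraph \<Rightarrow> bool" where
  "complete_bipartite_free s t G \<longleftrightarrow> \<not> (\<exists>H. subgraph H G \<and> K\<^bsub>s,t\<^esub> H)"

definition chord :: "complex set \<Rightarrow> bool" where
  "chord S \<longleftrightarrow> (\<exists>a\<in>sphere 0 1. \<exists>b\<in>sphere 0 1. a \<noteq> b \<and> S = closed_segment a b)"

(* The map c is an isomorphism onto the intersection graph of the finite set of chords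
   c ` verts G. Chords contain their endpoints, so two chords with a common endpoint
   intersect. *)
definition circle_graph :: "('a, 'b) pre_digraph \<Rightarrow> bool" where
  "circle_graph G \<longleftrightarrow> graph G \<and> verts G \<noteq> {} \<and>
     (\<exists>c. inj_on c (verts G) \<and> (\<forall>v\<in>verts G. chord (c v)) \<and>
       (\<forall>u\<in>verts G. \<forall>v\<in>verts G. u \<noteq> v \<longrightarrow>
         (u \<rightarrow>\<^bsub>G\<^esub> v \<longleftrightarrow> c u \<inter> c v \<noteq> {})))"

end

theory Submission
  imports Defs
begin

text \<open>
  The graphs are blow-ups: every vertex of a small graph is replaced by \<open>n\<close> pairwise
  nonadjacent twins, which multiplies all degrees by \<open>n\<close>.

  If \<open>t - 1\<close> is at least \<open>2 s - 2\<close>, blow up a single edge with \<open>n = t - 1\<close>. All degrees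
  equal \<open>t - 1\<close>, so no vertex has the \<open>t\<close> neighbours that a copy of \<open>K\<^sub>s\<^sub>,\<^sub>t\<close> needs. (For
  \<open>t = 1\<close> a single vertex is taken, because the blow-up would be empty.) Otherwise, blow up
  the hexagon with \<open>n = s - 1\<close>. All degrees equal \<open>2 s - 2\<close>. In a copy of \<open>K\<^sub>s\<^sub>,\<^sub>t\<close> the \<open>s\<close>
  vertices of one side cannot fit into one class of \<open>s - 1\<close> twins; but two different vertices
  of a hexagon have at most one common neighbour, so two vertices from different classes have
  at most \<open>s - 1 < t\<close> common neighbours. The two arguments are the lemmas
  \<open>complete_bipartite_free_blowup_degree\<close> and \<open>complete_bipartite_free_blowup_codegree\<close>.

  Blowing up preserves circle graphs, since a chord can be replaced by a bundle of nearby
  disjoint chords. To make this precise, the circle without one point is parametrized by the real line: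
  two chords with four distinct ends cross exactly when the corresponding intervals overlap
  without nesting (\<open>circle_chords_meet_iff_overlap\<close>). A graph of overlapping intervals with
  distinct integer ends is blown up by nesting \<open>n\<close> copies of each interval, shrunk by less than
  \<open>1/2\<close> at either end (\<open>circle_graph_blowup\<close>). It remains to draw the edge and the hexagon as
  overlapping intervals.
\<close>

section \<open>Chords of the circle and overlapping intervals\<close>

text \<open>
  Inverse stereographic projection: a rational parametrization makes every incidence
  question below a polynomial identity.
\<close>

definition circle_point :: "real \<Rightarrow> complex" where
  "circle_point x = Complex ((1 - x\<^sup>2) / (1 + x\<^sup>2)) (2 * x / (1 + x\<^sup>2))"

lemma one_plus_square_pos: "0 < 1 + x\<^sup>2" for x :: real
  by (simp add: add_pos_nonneg)

lemma scaled_circle_point: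
  "(1 + x\<^sup>2) *\<^sub>R circle_point x = Complex (1 - x\<^sup>2) (2 * x)"
  using one_plus_square_pos[of x]
  by (simp add: circle_point_def complex_eq_iff)

lemma circle_point_in_sphere: "circle_point x \<in> sphere 0 1"
proof -
  have "(1 - x\<^sup>2)\<^sup>2 + (2 * x)\<^sup>2 = (1 + x\<^sup>2)\<^sup>2"
    by algebra
  then have "((1 - x\<^sup>2) / (1 + x\<^sup>2))\<^sup>2 + (2 * x / (1 + x\<^sup>2))\<^sup>2 = 1"
    using one_plus_square_pos[of x]
    by (simp add: power_divide flip: add_divide_distrib)
  then show ?thesis
    by (simp add: circle_point_def cmod_def)
qed

text \<open>
  The linear form vanishing on the line through the circle points with parameters \<open>x\<close> and
  \<open>y\<close>; for \<open>x = y\<close> that line is the tangent.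
\<close>

definition line_form :: "real \<Rightarrow> real \<Rightarrow> complex \<Rightarrow> real" where
  "line_form x y m = (1 - x * y) * Re m + (x + y) * Im m - (1 + x * y)"

text \<open>
  The factorization reads off from the order of the parameters on which side of a chord a
  circle point lies.
\<close>

lemma line_form_circle_point:
  "line_form x y (circle_point z) = - 2 * (z - x) * (z - y) / (1 + z\<^sup>2)"
proof -
  have "(1 + z\<^sup>2) * line_form x y (circle_point z) = - 2 * (z - x) * (z - y)"
  proof -
    have "(1 + z\<^sup>2) * Re (circle_point z) = 1 - z\<^sup>2" "(1 + z\<^sup>2) * Im (circle_point z) = 2 * z"
      using scaled_circle_point[of z] by (simp_all add: complex_eq_iff)
    then show ?thesis
      unfolding line_form_def by algebra
  qed
  then show ?thesis
    using one_plus_square_pos[of z] by (simp add: field_simps)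
qed

lemma circle_point_eq_iff: "circle_point x = circle_point y \<longleftrightarrow> x = y"
proof
  assume "circle_point x = circle_point y"
  moreover have "line_form x x (circle_point x) = 0"
    by (simp add: line_form_circle_point)
  ultimately have "line_form x x (circle_point y) = 0"
    by simp
  then show "x = y"
    using one_plus_square_pos[of y] by (auto simp: line_form_circle_point)
qed simp

lemma line_form_segment:
  assumes "m \<in> closed_segment a b"
  obtains r where "0 \<le> r" "r \<le> 1"
    "line_form x y m = (1 - r) * line_form x y a + r * line_form x y b"
proof -
  obtain r where "0 \<le> r" "r \<le> 1" and m: "m = (1 - r) *\<^sub>R a + r *\<^sub>R b"
    using assms by (auto simp: in_segment)
  moreover have "line_form x y m = (1 - r) * line_form x y a + r * line_form x y b"
    unfolding line_form_def m by (simp add: algebra_simps)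
  ultimately show ?thesis using that by blast
qed

definition circle_chord :: "real \<Rightarrow> real \<Rightarrow> complex set" where
  "circle_chord x y = closed_segment (circle_point x) (circle_point y)"

lemma line_form_circle_chord:
  assumes "m \<in> circle_chord x y"
  shows "line_form x y m = 0"
proof -
  obtain r where
    "line_form x y m = (1 - r) * line_form x y (circle_point x) + r * line_form x y (circle_point y)"
    using assms line_form_segment unfolding circle_chord_def by metis
  then show ?thesis
    by (simp add: line_form_circle_point)
qed

text \<open>
  The hypothesis says that the ends of the second chord lie strictly on the same side of the
  line carrying the first.
\<close>

lemma circle_chords_disjoint:
  assumes "(z - x) * (z - y) * ((w - x) * (w - y)) > 0"
  shows "circle_chord x y \<inter> circle_chord z w = {}"
proof (rule ccontr)
  assume "\<not> ?thesis"
  then obtain m where m: "m \<in> circle_chord x y" "m \<in> circle_chord z w"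
    by blast
  let ?p = "line_form x y (circle_point z)" and ?q = "line_form x y (circle_point w)"
  obtain r where r: "0 \<le> r" "r \<le> 1" "line_form x y m = (1 - r) * ?p + r * ?q"
    using m(2) line_form_segment unfolding circle_chord_def by metis
  have "?p * ?q = 4 * ((z - x) * (z - y) * ((w - x) * (w - y))) / ((1 + z\<^sup>2) * (1 + w\<^sup>2))"
    by (simp add: line_form_circle_point algebra_simps)
  also have "\<dots> > 0"
    using assms by (intro divide_pos_pos mult_pos_pos[OF one_plus_square_pos one_plus_square_pos]) simp
  finally have "?p > 0 \<and> ?q > 0 \<or> ?p < 0 \<and> ?q < 0"
    by (simp add: zero_less_mult_iff)
  moreover have "(1 - r) * ?p + r * ?q = 0"
    using r(3) line_form_circle_chord[OF m(1)] by simp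
  moreover have "(1 - r) * a + r * b > 0" if "a > 0" "b > 0" for a b
    using r that by (cases "r = 0") (auto intro!: add_nonneg_pos)
  from this[of ?p ?q] this[of "- ?p" "- ?q"]
  have "?p > 0 \<and> ?q > 0 \<or> ?p < 0 \<and> ?q < 0 \<Longrightarrow> (1 - r) * ?p + r * ?q \<noteq> 0"
    by auto
  ultimately show False by blast
qed

text \<open>
  The vectors \<open>(1 - x\<^sup>2, 2 x, 1 + x\<^sup>2)\<close> are homogeneous coordinates of the circle points.
  In these coordinates every positive combination of the ends describes a point of the chord,
  whatever the sum of its coefficients, so intersection points come from polynomial weights.
\<close>

lemma weighted_point_in_circle_chord:
  assumes "a > 0" "b > 0"
    and "(a * (1 + x\<^sup>2) + b * (1 + y\<^sup>2)) *\<^sub>R m =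
      a *\<^sub>R Complex (1 - x\<^sup>2) (2 * x) + b *\<^sub>R Complex (1 - y\<^sup>2) (2 * y)"
  shows "m \<in> circle_chord x y"
proof -
  define A B where "A = a * (1 + x\<^sup>2)" and "B = b * (1 + y\<^sup>2)"
  have pos: "A > 0" "B > 0"
    unfolding A_def B_def using assms one_plus_square_pos by simp_all
  have "(A + B) *\<^sub>R m = A *\<^sub>R circle_point x + B *\<^sub>R circle_point y"
    using assms(3) unfolding A_def B_def
    by (simp flip: scaled_circle_point)
  then have "(1 / (A + B)) *\<^sub>R ((A + B) *\<^sub>R m) =
      (1 / (A + B)) *\<^sub>R (A *\<^sub>R circle_point x + B *\<^sub>R circle_point y)"
    by simp
  then have "m = (A / (A + B)) *\<^sub>R circle_point x + (B / (A + B)) *\<^sub>R circle_point y"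
    using pos by (simp add: scaleR_right_distrib)
  moreover have "A / (A + B) = 1 - B / (A + B)"
    using pos by (simp add: field_simps)
  ultimately have "m = (1 - B / (A + B)) *\<^sub>R circle_point x + (B / (A + B)) *\<^sub>R circle_point y"
    by simp
  moreover have "0 \<le> B / (A + B)" "B / (A + B) \<le> 1"
    using pos by simp_all
  ultimately show ?thesis
    unfolding circle_chord_def in_segment by blast
qed

text \<open>
  The third divided difference of a quadratic polynomial over four nodes vanishes, and its
  coefficients alternate in sign along the nodes. Applied to the homogeneous coordinates, this
  equates a positive combination of the ends of one chord with a positive combination of the
  ends of the other.
\<close>

lemma circle_chords_meet:
  assumes "x < z" "z < y" "y < w"
  shows "circle_chord x y \<inter> circle_chord z w \<noteq> {}"
proof -
  \<comment> \<open>The divided difference coefficients, multiplied by the Vandermonde determinant.\<close>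
  define a b c d where
    "a = (y - z) * (w - z) * (w - y)" and "b = (z - x) * (w - x) * (w - z)" and
    "c = (y - x) * (w - x) * (w - y)" and "d = (z - x) * (y - x) * (y - z)"
  note weights = a_def b_def c_def d_def
  have pos: "a > 0" "b > 0" "c > 0" "d > 0"
    unfolding weights using assms by simp_all
  have balance: "a + b = c + d" "a * x + b * y = c * z + d * w"
    "a * x\<^sup>2 + b * y\<^sup>2 = c * z\<^sup>2 + d * w\<^sup>2"
    unfolding weights by algebra+
  define N where "N = a * (1 + x\<^sup>2) + b * (1 + y\<^sup>2)"
  have N: "N = c * (1 + z\<^sup>2) + d * (1 + w\<^sup>2)"
    unfolding N_def using balance by algebra
  have "N > 0"
    unfolding N_def using pos one_plus_square_pos by (simp add: add_pos_pos)
  define q where "q = a *\<^sub>R Complex (1 - x\<^sup>2) (2 * x) + b *\<^sub>R Complex (1 - y\<^sup>2) (2 * y)"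
  have q: "q = c *\<^sub>R Complex (1 - z\<^sup>2) (2 * z) + d *\<^sub>R Complex (1 - w\<^sup>2) (2 * w)"
    unfolding q_def complex_eq_iff using balance by (simp; algebra)
  define m where "m = (1 / N) *\<^sub>R q"
  have "N *\<^sub>R m = q"
    unfolding m_def using \<open>N > 0\<close> by simp
  then have "m \<in> circle_chord x y" "m \<in> circle_chord z w"
    using weighted_point_in_circle_chord[of a b x y m, folded N_def q_def]
      weighted_point_in_circle_chord[of c d z w m, folded N q] pos by simp_all
  then show ?thesis by blast
qed

definition overlap :: "'a::linorder \<Rightarrow> 'a \<Rightarrow> 'a \<Rightarrow> 'a \<Rightarrow> bool" where
  "overlap x y z w \<longleftrightarrow> x < z \<and> z < y \<and> y < w \<or> z < x \<and> x < w \<and> w < y"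

lemma circle_chords_meet_iff_overlap:
  assumes "x < y" "z < w" "x \<noteq> z" "x \<noteq> w" "y \<noteq> z" "y \<noteq> w"
  shows "circle_chord x y \<inter> circle_chord z w \<noteq> {} \<longleftrightarrow> overlap x y z w"
proof
  assume "overlap x y z w"
  then show "circle_chord x y \<inter> circle_chord z w \<noteq> {}"
    unfolding overlap_def using circle_chords_meet[of x z y w] circle_chords_meet[of z x w y]
    by (auto simp: Int_commute)
next
  assume meet: "circle_chord x y \<inter> circle_chord z w \<noteq> {}"
  show "overlap x y z w"
  proof (rule ccontr)
    assume "\<not> overlap x y z w"
    then consider "w < x \<or> y < z \<or> z < x \<and> y < w" | "x < z \<and> w < y"
      unfolding overlap_def using assms by linarith
    then have "(z - x) * (z - y) * ((w - x) * (w - y)) > 0"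
    proof cases
      case 1
      then show ?thesis
        using assms by (auto simp: zero_less_mult_iff mult_less_0_iff)
    next
      case 2
      then show ?thesis
        using assms by (auto simp: zero_less_mult_iff mult_less_0_iff)
    qed
    then show False
      using meet circle_chords_disjoint by blast
  qed
qed

lemma circle_chord_is_chord: "x \<noteq> y \<Longrightarrow> chord (circle_chord x y)"
  unfolding chord_def circle_chord_def
  using circle_point_in_sphere circle_point_eq_iff by blast

lemma circle_chord_endpoint:
  assumes "circle_point z \<in> circle_chord x y"
  shows "z = x \<or> z = y"
proof -
  have "(z - x) * (z - y) / (1 + z\<^sup>2) = 0"
    using line_form_circle_chord[OF assms] by (auto simp: line_form_circle_point)
  then show ?thesis
    using one_plus_square_pos[of z] by auto
qed

text \<open>
  Distinct ends also make the chords themselves distinct, as a chord contains no circle points besides its ends.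
\<close>

lemma circle_graph_if_overlap:
  assumes "graph (with_proj G)" "pverts G \<noteq> {}"
    and less: "\<And>v. v \<in> pverts G \<Longrightarrow> x v < y v"
    and distinct: "\<And>u v. u \<in> pverts G \<Longrightarrow> v \<in> pverts G \<Longrightarrow> u \<noteq> v \<Longrightarrow>
      x u \<noteq> x v \<and> x u \<noteq> y v \<and> y u \<noteq> x v \<and> y u \<noteq> y v"
    and arcs: "\<And>u v. u \<in> pverts G \<Longrightarrow> v \<in> pverts G \<Longrightarrow> u \<noteq> v \<Longrightarrow>
      (u, v) \<in> parcs G \<longleftrightarrow> overlap (x u) (y u) (x v) (y v :: real)"
  shows "circle_graph (with_proj G)"
proof -
  define c where "c v = circle_chord (x v) (y v)" for v
  have "inj_on c (pverts G)"
  proof (rule inj_onI)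
    fix u v assume uv: "u \<in> pverts G" "v \<in> pverts G" "c u = c v"
    have "circle_point (x u) \<in> c u"
      unfolding c_def circle_chord_def by simp
    then have "x u = x v \<or> x u = y v"
      using uv(3) circle_chord_endpoint unfolding c_def by blast
    then show "u = v"
      using distinct uv by blast
  qed
  moreover have "chord (c v)" if "v \<in> pverts G" for v
    unfolding c_def using less[OF that] by (intro circle_chord_is_chord) simp
  moreover have "(u, v) \<in> parcs G \<longleftrightarrow> c u \<inter> c v \<noteq> {}"
    if "u \<in> pverts G" "v \<in> pverts G" "u \<noteq> v" for u v
    unfolding c_def arcs[OF that]
    using circle_chords_meet_iff_overlap less that distinct[OF that] by metis
  ultimately show ?thesis
    unfolding circle_graph_def using assms(1,2) by auto
qed

section \<open>Blow-ups\<close>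

text \<open>
  The vertex \<open>v\<close> is the copy number \<open>v div k\<close> of the vertex \<open>v mod k\<close> of \<open>E\<close>.
\<close>

definition blowup :: "nat \<Rightarrow> (nat \<Rightarrow> nat \<Rightarrow> bool) \<Rightarrow> nat \<Rightarrow> nat pair_pre_digraph" where
  "blowup k E n = \<lparr> pverts = {..<k * n},
     parcs = {(u, v). u < k * n \<and> v < k * n \<and> E (u mod k) (v mod k)} \<rparr>"

lemma blowup_simps [simp]:
  "pverts (blowup k E n) = {..<k * n}"
  "(u, v) \<in> parcs (blowup k E n) \<longleftrightarrow> u < k * n \<and> v < k * n \<and> E (u mod k) (v mod k)"
  by (simp_all add: blowup_def)

lemma graph_blowup:
  assumes "symp E" "irreflp E"
  shows "graph (with_proj (blowup k E n))"
proof -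
  have "parcs (blowup k E n) \<subseteq> {..<k * n} \<times> {..<k * n}"
    by auto
  then have "finite (parcs (blowup k E n))"
    using finite_subset by blast
  then have "pair_graph (blowup k E n)"
    using assms
    by unfold_locales
      (auto simp: blowup_def symmetric_def arcs_ends_conv intro!: symI dest: sympD irreflpD)
  then interpret pair_graph "blowup k E n" .
  show ?thesis by unfold_locales
qed

text \<open>
  With \<open>J\<close> a set of vertices of the small graph, this counts the twins of its elements; all
  degree and codegree computations reduce to it.
\<close>

lemma card_residue_classes:
  assumes "J \<subseteq> {..<k}"
  shows "card {w. w < k * n \<and> w mod k \<in> J} = n * card J"
proof -
  have "bij_betw (\<lambda>(q, j). k * q + j) ({..<n} \<times> J) {w. w < k * n \<and> w mod k \<in> J}"
  proof (rule bij_betw_byWitness[where f' = "\<lambda>w. (w div k, w mod k)"])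
    show "(\<lambda>(q, j). k * q + j) ` ({..<n} \<times> J) \<subseteq> {w. w < k * n \<and> w mod k \<in> J}"
    proof (rule image_subsetI)
      fix p assume "p \<in> {..<n} \<times> J"
      then obtain q j where p: "p = (q, j)" and "q < n" "j \<in> J" by auto
      then have "j < k" "Suc q \<le> n" using assms by auto
      then have "k * q + j < k * Suc q" "k * Suc q \<le> k * n"
        by (simp, meson mult_le_mono2)
      then have "k * q + j < k * n" by linarith
      moreover have "(k * q + j) mod k \<in> J" using \<open>j \<in> J\<close> \<open>j < k\<close> by simp
      ultimately show "(case p of (q, j) \<Rightarrow> k * q + j) \<in> {w. w < k * n \<and> w mod k \<in> J}"
        unfolding p by simp
    qed
  qed (use assms in \<open>auto simp: less_mult_imp_div_less mult.commute\<close>)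
  then have "card {w. w < k * n \<and> w mod k \<in> J} = card ({..<n} \<times> J)"
    using bij_betw_same_card[symmetric] by blast
  then show ?thesis
    by (simp add: card_cartesian_product)
qed

lemma out_degree_blowup:
  assumes "v < k * n"
  shows "out_degree (with_proj (blowup k E n)) v = n * card {j. j < k \<and> E (v mod k) j}"
proof -
  have "k > 0" using assms by (cases k) auto
  have "out_arcs (with_proj (blowup k E n)) v =
      Pair v ` {w. w < k * n \<and> w mod k \<in> {j. j < k \<and> E (v mod k) j}}"
    using assms \<open>k > 0\<close> by (auto simp: out_arcs_def)
  then have "out_degree (with_proj (blowup k E n)) v =
      card {w. w < k * n \<and> w mod k \<in> {j. j < k \<and> E (v mod k) j}}"
    unfolding out_degree_def by (simp add: card_image inj_on_def)
  also have "\<dots> = n * card {j. j < k \<and> E (v mod k) j}"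
    by (rule card_residue_classes) auto
  finally show ?thesis .
qed

lemma min_degree_blowup:
  assumes "0 < k" "0 < n" "\<And>i. i < k \<Longrightarrow> card {j. j < k \<and> E i j} = d"
  shows "min_degree (with_proj (blowup k E n)) = d * n"
proof -
  have "out_degree (with_proj (blowup k E n)) ` {..<k * n} = (\<lambda>_. d * n) ` {..<k * n}"
    using assms by (intro image_cong) (simp_all add: out_degree_blowup)
  also have "\<dots> = {d * n}"
    using assms by (auto simp: image_constant_conv lessThan_empty_iff)
  finally show ?thesis
    by (simp add: min_degree_def)
qed

lemma bipartite_blowup:
  fixes P :: "nat \<Rightarrow> bool"
  assumes "symp E" "irreflp E" "\<And>i j. E i j \<Longrightarrow> P i \<noteq> P j"
  shows "bipartite_graph (with_proj (blowup k E n))"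
  unfolding bipartite_graph_def
proof (intro conjI exI)
  let ?U = "{v. v < k * n \<and> P (v mod k)}" and ?V = "{v. v < k * n \<and> \<not> P (v mod k)}"
  show "graph (with_proj (blowup k E n))"
    using assms(1,2) by (rule graph_blowup)
  show "verts (with_proj (blowup k E n)) = ?U \<union> ?V" by auto
  show "?U \<inter> ?V = {}" by auto
  show "arcs_ends (with_proj (blowup k E n)) \<subseteq> ?U \<times> ?V \<union> ?V \<times> ?U"
    using assms(3) by fastforce
qed

lemma complete_bipartite_free_with_projI:
  assumes "\<And>U V. finite U \<Longrightarrow> finite V \<Longrightarrow> card U = s \<Longrightarrow> card V = t \<Longrightarrow>
    U \<subseteq> pverts G \<Longrightarrow> V \<subseteq> pverts G \<Longrightarrow> U \<times> V \<subseteq> parcs G \<Longrightarrow> False"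
  shows "complete_bipartite_free s t (with_proj G)"
  unfolding complete_bipartite_free_def
proof safe
  fix H assume sub: "subgraph H (with_proj G)" and K: "K\<^bsub>s,t\<^esub> H"
  obtain U V where UV: "verts H = U \<union> V" "card U = s" "card V = t"
      "arcs_ends H = U \<times> V \<union> V \<times> U" and "graph H"
    using K unfolding complete_bipartite_digraph_def by blast
  interpret H: graph H by fact
  have "finite U" "finite V"
    using H.finite_verts UV(1) by simp_all
  moreover have "U \<subseteq> pverts G" "V \<subseteq> pverts G"
    using sub UV(1) unfolding subgraph_def by auto
  moreover have "arcs_ends H \<subseteq> parcs G"
    using sub unfolding subgraph_def compatible_def
    by (auto simp: arcs_ends_def arc_to_ends_def)
  then have "U \<times> V \<subseteq> parcs G"
    using UV(4) by blast
  ultimately show False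
    using assms UV(2,3) by blast
qed

lemma complete_bipartite_free_blowup_degree:
  assumes "0 < s" "\<And>i. i < k \<Longrightarrow> n * card {j. j < k \<and> E i j} < t"
  shows "complete_bipartite_free s t (with_proj (blowup k E n))"
proof (rule complete_bipartite_free_with_projI)
  fix U V assume UV: "finite U" "card U = s" "card V = t"
    "U \<subseteq> pverts (blowup k E n)" "U \<times> V \<subseteq> parcs (blowup k E n)"
  have "U \<noteq> {}"
    using UV(2) assms(1) by auto
  then obtain u where "u \<in> U" by blast
  then have "u < k * n" using UV(4) by auto
  then have "k > 0" by (cases k) auto
  let ?J = "{j. j < k \<and> E (u mod k) j}"
  have "V \<subseteq> {w. w < k * n \<and> w mod k \<in> ?J}"
    using UV(5) \<open>u \<in> U\<close> \<open>k > 0\<close> by auto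
  then have "card V \<le> card {w. w < k * n \<and> w mod k \<in> ?J}"
    by (intro card_mono) auto
  also have "\<dots> = n * card ?J"
    by (rule card_residue_classes) auto
  also have "\<dots> < t"
    using assms(2) \<open>k > 0\<close> by simp
  finally show False using UV(3) by simp
qed

text \<open>
  Each class has \<open>n < s\<close> elements, so one side of a copy of \<open>K\<^sub>s\<^sub>,\<^sub>t\<close> meets two classes, and
  the other side lies in the common neighbourhood of these, which is at most one class.
\<close>

lemma complete_bipartite_free_blowup_codegree:
  assumes "n < s" "n < t"
    and codegree: "\<And>i i'. i < k \<Longrightarrow> i' < k \<Longrightarrow> i \<noteq> i' \<Longrightarrow> card {j. j < k \<and> E i j \<and> E i' j} \<le> 1"
  shows "complete_bipartite_free s t (with_proj (blowup k E n))"
proof (rule complete_bipartite_free_with_projI)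
  fix U V assume UV: "finite U" "card U = s" "card V = t"
    "U \<subseteq> pverts (blowup k E n)" "U \<times> V \<subseteq> parcs (blowup k E n)"
  have "U \<noteq> {}"
    using UV(2) assms(1) by auto
  then obtain u where "u \<in> U" by blast
  then have "u < k * n" using UV(4) by auto
  then have "k > 0" by (cases k) auto
  have "\<not> U \<subseteq> {w. w < k * n \<and> w mod k \<in> {u mod k}}"
  proof
    assume "U \<subseteq> {w. w < k * n \<and> w mod k \<in> {u mod k}}"
    then have "card U \<le> card {w. w < k * n \<and> w mod k \<in> {u mod k}}"
      by (intro card_mono) auto
    also have "\<dots> = n * card {u mod k}"
      by (rule card_residue_classes) (use \<open>k > 0\<close> in auto)
    finally show False using UV(2) assms(1) by simp
  qed
  then obtain u' where "u' \<in> U" "u' mod k \<noteq> u mod k"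
    using UV(4) by auto
  let ?J = "{j. j < k \<and> E (u mod k) j \<and> E (u' mod k) j}"
  have "V \<subseteq> {w. w < k * n \<and> w mod k \<in> ?J}"
    using UV(5) \<open>u \<in> U\<close> \<open>u' \<in> U\<close> \<open>k > 0\<close> by auto
  then have "card V \<le> card {w. w < k * n \<and> w mod k \<in> ?J}"
    by (intro card_mono) auto
  also have "\<dots> = n * card ?J"
    by (rule card_residue_classes) auto
  also have "\<dots> \<le> n * 1"
    using \<open>k > 0\<close> \<open>u' mod k \<noteq> u mod k\<close> by (intro mult_le_mono2 codegree) auto
  finally show False using UV(3) assms(2) by simp
qed

text \<open>
  Twins get nested intervals, which do not overlap. Moving integers by less than \<open>1/2\<close>
  cannot change the order of different ones, so intervals of different classes overlap exactly
  as the original ones do.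
\<close>

lemma circle_graph_blowup:
  fixes x y :: "nat \<Rightarrow> int"
  assumes "0 < k" "0 < n" "symp E" "irreflp E"
    and less: "\<And>i. i < k \<Longrightarrow> x i < y i"
    and distinct: "\<And>i j. i < k \<Longrightarrow> j < k \<Longrightarrow> i \<noteq> j \<Longrightarrow>
      x i \<noteq> x j \<and> x i \<noteq> y j \<and> y i \<noteq> x j \<and> y i \<noteq> y j"
    and overlap: "\<And>i j. i < k \<Longrightarrow> j < k \<Longrightarrow> i \<noteq> j \<Longrightarrow> E i j \<longleftrightarrow> overlap (x i) (y i) (x j) (y j)"
  shows "circle_graph (with_proj (blowup k E n))"
proof -
  \<comment> \<open>Dividing by \<open>2 n\<close> keeps all shifts below \<open>1/2\<close>.\<close>
  define e where "e v = real (v div k) / (2 * real n)" for v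
  define X Y where "X v = of_int (x (v mod k)) + e v" and "Y v = of_int (y (v mod k)) - e v" for v
  have e: "0 \<le> e v" "e v < 1 / 2" if "v < k * n" for v
  proof -
    have "v div k < n"
      using that by (simp add: less_mult_imp_div_less mult.commute)
    then show "e v < 1 / 2" "0 \<le> e v"
      unfolding e_def by (simp_all add: field_simps)
  qed
  have int_less: "of_int a + r < of_int b + q \<longleftrightarrow> a < b"
    if "a \<noteq> b" "\<bar>r\<bar> < 1 / 2" "\<bar>q\<bar> < 1 / 2" for a b :: int and r q :: real
  proof (cases "a < b")
    case True
    then have "real_of_int a + 1 \<le> of_int b" by linarith
    then show ?thesis using that True by linarith
  next
    case False
    then have "real_of_int b + 1 \<le> of_int a" using that by linarith
    then show ?thesis using that False by linarith
  qed
  show ?thesis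
  proof (rule circle_graph_if_overlap[where x = X and y = Y])
    show "graph (with_proj (blowup k E n))"
      using assms(3,4) by (rule graph_blowup)
    show "pverts (blowup k E n) \<noteq> {}"
      using assms(1,2) by (auto simp: lessThan_empty_iff)
    show "X v < Y v" if "v \<in> pverts (blowup k E n)" for v
    proof -
      have "x (v mod k) < y (v mod k)" using less assms(1) by simp
      then show ?thesis
        using int_less[of "x (v mod k)" "y (v mod k)" "e v" "- e v"] e[of v] that
        unfolding X_def Y_def by simp
    qed
    fix u v assume uv: "u \<in> pverts (blowup k E n)" "v \<in> pverts (blowup k E n)" "u \<noteq> v"
    then have eu: "0 \<le> e u" "e u < 1 / 2" and ev: "0 \<le> e v" "e v < 1 / 2"
      using e by simp_all
    have "(X u \<noteq> X v \<and> X u \<noteq> Y v \<and> Y u \<noteq> X v \<and> Y u \<noteq> Y v) \<and>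
      ((u, v) \<in> parcs (blowup k E n) \<longleftrightarrow> overlap (X u) (Y u) (X v) (Y v))"
    proof (cases "u mod k = v mod k")
      case True
      then have "u div k \<noteq> v div k"
        using uv(3) by (metis div_mult_mod_eq)
      then have "e u \<noteq> e v"
        unfolding e_def using assms(2) by simp
      moreover have "real_of_int (x (v mod k)) + 1 \<le> of_int (y (v mod k))"
        using less[of "v mod k"] assms(1) by simp
      ultimately show ?thesis
        using eu ev assms(4) True unfolding X_def Y_def overlap_def
        by (auto dest: irreflpD)
    next
      case False
      have "u mod k < k" "v mod k < k" using assms(1) by simp_all
      note d = distinct[OF this False]
      have abs: "\<bar>e u\<bar> < 1 / 2" "\<bar>- e u\<bar> < 1 / 2" "\<bar>e v\<bar> < 1 / 2" "\<bar>- e v\<bar> < 1 / 2"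
        using eu ev by simp_all
      have order: "X u < X v \<longleftrightarrow> x (u mod k) < x (v mod k)" "X v < X u \<longleftrightarrow> x (v mod k) < x (u mod k)"
        "X u < Y v \<longleftrightarrow> x (u mod k) < y (v mod k)" "Y v < X u \<longleftrightarrow> y (v mod k) < x (u mod k)"
        "Y u < X v \<longleftrightarrow> y (u mod k) < x (v mod k)" "X v < Y u \<longleftrightarrow> x (v mod k) < y (u mod k)"
        "Y u < Y v \<longleftrightarrow> y (u mod k) < y (v mod k)" "Y v < Y u \<longleftrightarrow> y (v mod k) < y (u mod k)"
        unfolding X_def Y_def diff_conv_add_uminus
        by (rule int_less; use abs d in argo)+
      have "X u \<noteq> X v \<and> X u \<noteq> Y v \<and> Y u \<noteq> X v \<and> Y u \<noteq> Y v"
        using order d by (metis linorder_neqE less_irrefl)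
      moreover have "(u, v) \<in> parcs (blowup k E n) \<longleftrightarrow> overlap (X u) (Y u) (X v) (Y v)"
        using uv overlap[OF \<open>u mod k < k\<close> \<open>v mod k < k\<close> False]
        unfolding overlap_def order by simp
      ultimately show ?thesis by blast
    qed
    then show "X u \<noteq> X v \<and> X u \<noteq> Y v \<and> Y u \<noteq> X v \<and> Y u \<noteq> Y v"
      and "(u, v) \<in> parcs (blowup k E n) \<longleftrightarrow> overlap (X u) (Y u) (X v) (Y v)"
      by blast+
  qed
qed

section \<open>The extremal graphs\<close>

lemma single_vertex_graph:
  fixes E defines "E \<equiv> \<lambda>i j :: nat. False"
  shows "circle_graph (with_proj (blowup 1 E 1))" "bipartite_graph (with_proj (blowup 1 E 1))"
    "min_degree (with_proj (blowup 1 E 1)) = 0"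
    "0 < s \<Longrightarrow> 0 < t \<Longrightarrow> complete_bipartite_free s t (with_proj (blowup 1 E 1))"
proof -
  have E: "symp E" "irreflp E"
    by (simp_all add: E_def sympI irreflpI)
  show "circle_graph (with_proj (blowup 1 E 1))"
    by (rule circle_graph_blowup[where x = "\<lambda>_. 0" and y = "\<lambda>_. 1"]) (simp_all add: E)
  show "bipartite_graph (with_proj (blowup 1 E 1))"
    by (rule bipartite_blowup[OF E]) (simp add: E_def)
  show "min_degree (with_proj (blowup 1 E 1)) = 0"
    by (subst min_degree_blowup[where d = 0]) (simp_all add: E_def)
  show "0 < s \<Longrightarrow> 0 < t \<Longrightarrow> complete_bipartite_free s t (with_proj (blowup 1 E 1))"
    by (rule complete_bipartite_free_blowup_degree) (simp_all add: E_def)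
qed

text \<open>
  The blow-up of an edge, drawn as the intervals \<open>[0, 2]\<close> and \<open>[1, 3]\<close>.
\<close>

lemma balanced_complete_bipartite_graph:
  fixes E defines "E \<equiv> \<lambda>i j :: nat. even i \<noteq> even j"
  assumes "0 < n"
  shows "circle_graph (with_proj (blowup 2 E n))" "bipartite_graph (with_proj (blowup 2 E n))"
    "min_degree (with_proj (blowup 2 E n)) = n"
    "0 < s \<Longrightarrow> n < t \<Longrightarrow> complete_bipartite_free s t (with_proj (blowup 2 E n))"
proof -
  have E: "symp E" "irreflp E"
    by (auto simp: E_def intro!: sympI irreflpI)
  have "{j. j < 2 \<and> E i j} = {1 - i}" if "i < 2" for i
    using that by (auto simp: E_def less_2_cases_iff)
  then have card: "card {j. j < 2 \<and> E i j} = 1" if "i < 2" for i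
    using that by simp
  show "circle_graph (with_proj (blowup 2 E n))"
    by (rule circle_graph_blowup[where x = "\<lambda>i. int i" and y = "\<lambda>i. int i + 2", OF _ assms(2) E])
      (auto simp: less_2_cases_iff E_def overlap_def)
  show "bipartite_graph (with_proj (blowup 2 E n))"
    by (rule bipartite_blowup[OF E]) (simp add: E_def)
  show "min_degree (with_proj (blowup 2 E n)) = n"
    using min_degree_blowup[of 2 n E 1] assms card by simp
  show "0 < s \<Longrightarrow> n < t \<Longrightarrow> complete_bipartite_free s t (with_proj (blowup 2 E n))"
    by (rule complete_bipartite_free_blowup_degree) (simp_all add: card)
qed

lemma less_6_cases: "i < 6 \<Longrightarrow> i \<in> {0, 1, 2, 3, 4, 5}" for i :: nat
  by auto

lemma hexagon_blowup:
  fixes E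
  defines "E \<equiv> \<lambda>i j :: nat. i < 6 \<and> j < 6 \<and> (j = (i + 1) mod 6 \<or> i = (j + 1) mod 6)"
  assumes "0 < n"
  shows "circle_graph (with_proj (blowup 6 E n))" "bipartite_graph (with_proj (blowup 6 E n))"
    "min_degree (with_proj (blowup 6 E n)) = 2 * n"
    "n < s \<Longrightarrow> n < t \<Longrightarrow> complete_bipartite_free s t (with_proj (blowup 6 E n))"
proof -
  have "E i j \<longleftrightarrow> j \<in> {(i + 1) mod 6, (i + 5) mod 6}" if "i < 6" "j < 6" for i j
    using less_6_cases[OF that(1)] less_6_cases[OF that(2)]
    by (elim insertE emptyE; simp add: E_def)
  then have nbrs: "{j. j < 6 \<and> E i j} = {(i + 1) mod 6, (i + 5) mod 6}" if "i < 6" for i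
    using that by auto
  have parity: "even i \<noteq> even j" if "E i j" for i j
  proof -
    have "i < 6" "j < 6" using that by (simp_all add: E_def)
    from this[THEN less_6_cases] that show ?thesis
      by (elim insertE emptyE; simp add: E_def)
  qed
  have "symp E"
    by (rule sympI) (simp only: E_def, blast)
  moreover have "irreflp E"
    using parity by (blast intro: irreflpI)
  ultimately have E: "symp E" "irreflp E" .
  \<comment> \<open>The intervals \<open>[2 i, 2 i + 3]\<close> with \<open>i < 5\<close> form a path; \<open>[1, 10]\<close> contains the three
    inner ones and overlaps the first and the last, closing the path to a hexagon.\<close>
  show "circle_graph (with_proj (blowup 6 E n))"
  proof (rule circle_graph_blowup[where
        x = "\<lambda>i. [0, 2, 4, 6, 8, 1] ! i" and y = "\<lambda>i. [3, 5, 7, 9, 11, 10] ! i", OF _ assms(2) E])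
    fix i j :: nat assume "i < 6" "j < 6" "i \<noteq> j"
    note cases = less_6_cases[OF \<open>i < 6\<close>] less_6_cases[OF \<open>j < 6\<close>] \<open>i \<noteq> j\<close>
    let ?x = "\<lambda>i. [0, 2, 4, 6, 8, 1 :: int] ! i" and ?y = "\<lambda>i. [3, 5, 7, 9, 11, 10 :: int] ! i"
    show "?x i \<noteq> ?x j \<and> ?x i \<noteq> ?y j \<and> ?y i \<noteq> ?x j \<and> ?y i \<noteq> ?y j"
      using cases by (elim insertE emptyE; simp)
    show "E i j \<longleftrightarrow> overlap (?x i) (?y i) (?x j) (?y j)"
      using cases by (elim insertE emptyE; simp add: E_def overlap_def)
  next
    fix i :: nat assume "i < 6"
    from less_6_cases[OF this]
    show "[0, 2, 4, 6, 8, 1 :: int] ! i < [3, 5, 7, 9, 11, 10] ! i"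
      by (elim insertE emptyE; simp)
  qed simp
  show "bipartite_graph (with_proj (blowup 6 E n))"
    by (rule bipartite_blowup[OF E, of even, OF parity])
  have "card {j. j < 6 \<and> E i j} = 2" if "i < 6" for i
    unfolding nbrs[OF that] using less_6_cases[OF that] by auto
  then show "min_degree (with_proj (blowup 6 E n)) = 2 * n"
    using assms by (intro min_degree_blowup) simp_all
  show "complete_bipartite_free s t (with_proj (blowup 6 E n))" if "n < s" "n < t"
  proof (rule complete_bipartite_free_blowup_codegree[OF that])
    fix i i' :: nat assume i: "i < 6" "i' < 6" "i \<noteq> i'"
    have common: "{j. j < 6 \<and> E i j \<and> E i' j} = {j. j < 6 \<and> E i j} \<inter> {j. j < 6 \<and> E i' j}"
      by blast
    show "card {j. j < 6 \<and> E i j \<and> E i' j} \<le> 1"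
      unfolding common nbrs[OF i(1)] nbrs[OF i(2)]
      using less_6_cases[OF i(1)] less_6_cases[OF i(2)] i(3)
      by (elim insertE emptyE; simp)
  qed
qed

theorem mainTheorem3:
  fixes s t :: nat
  assumes "1 \<le> s" and "s \<le> t"
  shows "\<exists>G :: nat pair_pre_digraph.
    circle_graph (with_proj G) \<and> bipartite_graph (with_proj G) \<and>
    complete_bipartite_free s t (with_proj G) \<and>
    min_degree (with_proj G) = max (2 * s - 2) (t - 1)"
proof -
  consider "t = 1" | "t > 1" "2 * s - 2 \<le> t - 1" | "t > 1" "t - 1 < 2 * s - 2"
    using assms by linarith
  then show ?thesis
  proof cases
    case 1
    then have "max (2 * s - 2) (t - 1) = 0" using assms by simp
    then show ?thesis
      using single_vertex_graph(1-3) single_vertex_graph(4)[of s t] assms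
      by (intro exI[of _ "blowup 1 (\<lambda>i j. False) 1"]) simp
  next
    case 2
    then have "0 < t - 1" "0 < s" "t - 1 < t" "max (2 * s - 2) (t - 1) = t - 1"
      using assms by simp_all
    then show ?thesis
      using balanced_complete_bipartite_graph[of "t - 1"]
      by (intro exI[of _ "blowup 2 (\<lambda>i j. even i \<noteq> even j) (t - 1)"]) simp
  next
    case 3
    then have "0 < s - 1" "s - 1 < s" "s - 1 < t" "max (2 * s - 2) (t - 1) = 2 * (s - 1)"
      using assms by auto
    then show ?thesis
      using hexagon_blowup[of "s - 1"] by (intro exI conjI) simp_all
  qed
qed

end
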